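(* For every integer $n\geq 0$, $Q_2(n)$ and $b_6(n)$ have the same parity.
   Context: A partition is called $6$-regular if none of its parts is divisible by $6$; $b_6(n)$ denotes the number of $6$-regular partitions of $n$. $Q_2(n)$ denotes the number of partitions of $n$ into distinct parts which are not congruent to $\pm 2$ modulo $6$. The empty partition is the only partition of $0$. *)

theory Defs
  imports "HOL-Number_Theory.Cong" "HOL-Library.Multiset"
begin

text \<open>A partition of \<open>n\<close> is the finite multiset of its parts, which are positive;
  the empty multiset is the only partition of \<open>0\<close>.\<close>

definition partitions_of :: "nat \<Rightarrow> nat multiset set" where
  "partitions_of n = {P. (\<forall>p \<in># P. 0 < p) \<and> sum_mset P = n}"

definition regular :: "nat \<Rightarrow> nat multiset \<Rightarrow> bool" where
  "regular l P \<longleftrightarrow> (\<forall>p \<in># P. \<not> l dvd p)"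

definition distinct_parts :: "nat multiset \<Rightarrow> bool" where
  "distinct_parts P \<longleftrightarrow> (\<forall>p \<in># P. count P p = 1)"

definition b6 :: "nat \<Rightarrow> nat" where
  "b6 n = card {P \<in> partitions_of n. regular 6 P}"

definition Q2 :: "nat \<Rightarrow> nat" where
  "Q2 n = card {P \<in> partitions_of n. distinct_parts P \<and>
     (\<forall>p \<in># P. \<not> [int p = 2] (mod 6) \<and> \<not> [int p = - 2] (mod 6))}"

text \<open>Hence the cardinalities above are genuine counts.\<close>

lemma size_le_sum_mset:
  fixes P :: "nat multiset"
  assumes "\<forall>p \<in># P. 0 < p"
  shows "size P \<le> sum_mset P"
  using assms by (induction P) auto

lemma finite_partitions_of: "finite (partitions_of n)"
proof (rule finite_subset)
  show "partitions_of n \<subseteq> mset ` {xs. set xs \<subseteq> {..n} \<and> length xs \<le> n}"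
  proof
    fix P assume P: "P \<in> partitions_of n"
    obtain xs where xs: "mset xs = P" using ex_mset by blast
    have "size P \<le> n" using P size_le_sum_mset by (auto simp: partitions_of_def)
    moreover have "p \<le> n" if "p \<in># P" for p
      using that P by (auto simp: partitions_of_def dest!: multi_member_split)
    ultimately show "P \<in> mset ` {xs. set xs \<subseteq> {..n} \<and> length xs \<le> n}"
      using xs by (intro image_eqI[of _ _ xs]) auto
  qed
  show "finite (mset ` {xs. set xs \<subseteq> {..n} \<and> length xs \<le> n})"
    by (intro finite_imageI finite_lists_length_le) simp
qed

end

theory Submission
  imports Defs
begin

text \<open>
  Both numbers have the parity of the number of pairs \<open>(E, P)\<close>, where \<open>E\<close> is a partition into
  distinct multiples of \<open>6\<close> and \<open>P\<close> is an arbitrary partition. Moving the smallest multiple of \<open>6\<close>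
  that occurs between \<open>E\<close> and \<open>P\<close> is an involution whose fixed points have \<open>E\<close> empty and
  \<open>P\<close> 6-regular. On the other hand, take the least \<open>k\<close> that has multiplicity at least \<open>2\<close> in \<open>P\<close>
  or for which \<open>2 k\<close> has odd multiplicity in \<open>P\<close>, and exchange \<open>2 k\<close> with \<open>k + k\<close>; this is an
  involution whose fixed points are the pairs with \<open>P\<close> consisting of distinct odd parts, so that
  \<open>E\<close> and \<open>P\<close> together form a partition counted by \<open>Q2\<close>.
\<close>

text \<open>The orbits \<open>{x, f x}\<close> are two-element sets that partition
  \<open>A\<close>.\<close>

lemma even_card_involution:
  assumes "finite A"
    and closed: "\<And>x. x \<in> A \<Longrightarrow> f x \<in> A"
    and invol: "\<And>x. x \<in> A \<Longrightarrow> f (f x) = x"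
    and nofix: "\<And>x. x \<in> A \<Longrightarrow> f x \<noteq> x"
  shows "even (card A)"
proof -
  let ?C = "(\<lambda>x. {x, f x}) ` A"
  have union: "\<Union>?C = A"
    using closed by blast
  have "2 dvd card (\<Union>?C)"
  proof (rule dvd_partition)
    show "finite (\<Union>?C)"
      using union \<open>finite A\<close> by simp
    have "card {x, f x} = 2" if "x \<in> A" for x
      using nofix[OF that] by (metis card_2_iff)
    then show "\<forall>c\<in>?C. 2 dvd card c"
      by auto
    show "\<forall>c\<^sub>1\<in>?C. \<forall>c\<^sub>2\<in>?C. c\<^sub>1 \<noteq> c\<^sub>2 \<longrightarrow> c\<^sub>1 \<inter> c\<^sub>2 = {}"
      using invol by auto metis+
  qed
  then show ?thesis
    using union by simp
qed

text \<open>Toggling at the least active index is a fixed-point-free involution on the elements that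
  have an active index: a toggle leaves the set of active indices unchanged, so the same least index
  is found on the way back.\<close>

lemma even_card_least_toggle:
  fixes active :: "'k::wellorder \<Rightarrow> 'a \<Rightarrow> bool"
  assumes "finite X"
    and closed: "\<And>k x. x \<in> X \<Longrightarrow> active k x \<Longrightarrow> t k x \<in> X"
    and invol: "\<And>k x. x \<in> X \<Longrightarrow> active k x \<Longrightarrow> t k (t k x) = x"
    and nofix: "\<And>k x. x \<in> X \<Longrightarrow> active k x \<Longrightarrow> t k x \<noteq> x"
    and active: "\<And>i k x. x \<in> X \<Longrightarrow> active k x \<Longrightarrow> active i (t k x) \<longleftrightarrow> active i x"
  shows "even (card X) \<longleftrightarrow> even (card {x \<in> X. \<forall>k. \<not> active k x})"
proof -
  let ?A = "{x \<in> X. \<exists>k. active k x}" and ?B = "{x \<in> X. \<forall>k. \<not> active k x}"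
  define k where "k x = (LEAST k. active k x)" for x
  have k: "active (k x) x" if "x \<in> ?A" for x
    unfolding k_def using that by (auto intro: LeastI)
  have kt: "k (t (k x) x) = k x" if "x \<in> ?A" for x
    unfolding k_def[of "t (k x) x"] using that k[OF that] by (simp add: active k_def)
  have "even (card ?A)"
  proof (rule even_card_involution[where f = "\<lambda>x. t (k x) x"])
    show "finite ?A"
      using \<open>finite X\<close> by simp
    fix x assume x: "x \<in> ?A"
    then have X: "x \<in> X"
      by simp
    show "t (k x) x \<in> ?A"
      using closed[OF X k[OF x]] active[OF X k[OF x]] k[OF x] by blast
    show "t (k (t (k x) x)) (t (k x) x) = x"
      using invol[OF X k[OF x]] kt[OF x] by simp
    show "t (k x) x \<noteq> x"
      by (rule nofix[OF X k[OF x]])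
  qed
  moreover have "card X = card (?A \<union> ?B)"
    by (rule arg_cong[where f = card]) auto
  moreover have "card (?A \<union> ?B) = card ?A + card ?B"
    using \<open>finite X\<close> by (intro card_Un_disjoint) auto
  ultimately show ?thesis
    by simp
qed

text \<open>A set encodes a partition into distinct parts. For \<open>l > 0\<close> the pairs are
  counted by the coefficient of q^n in the product over j >= 1 of (1 + q^(l j)) / (1 - q^j).\<close>

definition part_pairs :: "nat \<Rightarrow> nat \<Rightarrow> (nat set \<times> nat multiset) set" where
  "part_pairs l n = {(E, P). finite E \<and> (\<forall>k\<in>E. 0 < k \<and> l dvd k) \<and> (\<forall>p\<in>#P. 0 < p) \<and>
     \<Sum>E + sum_mset P = n}"

lemma finite_part_pairs: "finite (part_pairs l n)"
proof (rule finite_subset)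
  show "part_pairs l n \<subseteq> Pow {..n} \<times> (\<Union>m\<le>n. partitions_of m)"
  proof clarify
    fix E P assume EP: "(E, P) \<in> part_pairs l n"
    have "k \<le> n" if "k \<in> E" for k
      using EP that member_le_sum[of k E "\<lambda>k. k"] by (auto simp: part_pairs_def)
    moreover have "P \<in> (\<Union>m\<le>n. partitions_of m)"
      using EP by (auto simp: part_pairs_def partitions_of_def)
    ultimately show "E \<in> Pow {..n} \<and> P \<in> (\<Union>m\<le>n. partitions_of m)"
      by auto
  qed
qed (simp add: finite_partitions_of)

text \<open>Meant for \<open>k\<close> occurring in \<open>E\<close> or \<open>P\<close>; for any
  other \<open>k > 0\<close> nothing is removed from \<open>P\<close> and the total would
  grow.\<close>

fun toggle_part :: "nat \<Rightarrow> nat set \<times> nat multiset \<Rightarrow> nat set \<times> nat multiset" where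
  "toggle_part k (E, P) =
     (if k \<in> E then (E - {k}, add_mset k P) else (insert k E, P - {#k#}))"

text \<open>The active indices are the multiples of \<open>l\<close> occurring in \<open>E\<close>
  or \<open>P\<close>. A move may change where \<open>k\<close> occurs, but not whether it
  occurs.\<close>

lemma even_card_part_pairs_regular:
  "even (card (part_pairs l n)) \<longleftrightarrow> even (card {P \<in> partitions_of n. regular l P})"
proof -
  define active where
    "active k x \<longleftrightarrow> l dvd k \<and> (k \<in> fst x \<or> k \<in># snd x)" for k and x :: "nat set \<times> nat multiset"
  let ?B = "{x \<in> part_pairs l n. \<forall>k. \<not> active k x}"
  have "even (card (part_pairs l n)) \<longleftrightarrow> even (card ?B)"
  proof (rule even_card_least_toggle[where t = toggle_part, OF finite_part_pairs])
    fix k x assume "x \<in> part_pairs l n" and "active k x"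
    moreover obtain E P where x: "x = (E, P)"
      by (cases x)
    ultimately have EP: "(E, P) \<in> part_pairs l n" and k: "l dvd k" "k \<in> E \<or> k \<in># P"
      by (auto simp: active_def)
    show "toggle_part k x \<in> part_pairs l n"
    proof (cases "k \<in> E")
      case True
      then have "\<Sum>E = k + \<Sum>(E - {k})"
        using EP by (intro sum.remove) (auto simp: part_pairs_def)
      with True EP show ?thesis
        by (simp add: x part_pairs_def)
    next
      case False
      with k obtain Q where "P = add_mset k Q"
        by (metis multi_member_split)
      with False EP k show ?thesis
        by (simp add: x part_pairs_def)
    qed
    show "toggle_part k (toggle_part k x) = x"
      using k by (auto simp: x)
    show "toggle_part k x \<noteq> x"
      by (auto simp: x)
    show "active i (toggle_part k x) \<longleftrightarrow> active i x" for i
      using k by (cases "i = k") (auto simp: x active_def in_diff_count)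
  qed
  also have "?B = Pair {} ` {P \<in> partitions_of n. regular l P}"
  proof
    show "?B \<subseteq> Pair {} ` {P \<in> partitions_of n. regular l P}"
    proof
      fix x assume "x \<in> ?B"
      moreover obtain E P where x: "x = (E, P)"
        by (cases x)
      ultimately have EP: "(E, P) \<in> part_pairs l n" and "\<forall>k. l dvd k \<longrightarrow> k \<notin> E \<and> k \<notin># P"
        by (auto simp: active_def)
      then have "E = {}"
        by (auto simp: part_pairs_def)
      moreover have "P \<in> {P \<in> partitions_of n. regular l P}"
        using EP \<open>E = {}\<close> \<open>\<forall>k. l dvd k \<longrightarrow> k \<notin> E \<and> k \<notin># P\<close>
        by (auto simp: part_pairs_def partitions_of_def regular_def)
      ultimately show "x \<in> Pair {} ` {P \<in> partitions_of n. regular l P}"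
        by (simp add: x)
    qed
    show "Pair {} ` {P \<in> partitions_of n. regular l P} \<subseteq> ?B"
      by (auto simp: active_def part_pairs_def partitions_of_def regular_def)
  qed
  finally show ?thesis
    by (simp add: card_image inj_on_def)
qed

text \<open>The parity of the multiplicity of \<open>2 * k\<close> chooses the direction. Either
  exchange flips that parity, so a second application undoes the first.\<close>

fun split_part :: "nat \<Rightarrow> nat set \<times> nat multiset \<Rightarrow> nat set \<times> nat multiset" where
  "split_part k (E, P) =
     (E, if odd (count P (2 * k)) then P - {#2 * k#} + {#k, k#} else P - {#k, k#} + {#2 * k#})"

lemma even_card_part_pairs_distinct_odd:
  "even (card (part_pairs l n)) \<longleftrightarrow>
     even (card {(E, P) \<in> part_pairs l n. distinct_parts P \<and> (\<forall>p\<in>#P. odd p)})"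
proof -
  define active where
    "active k x \<longleftrightarrow> 2 \<le> count (snd x) k \<or> odd (count (snd x) (2 * k))"
    for k and x :: "nat set \<times> nat multiset"
  let ?B = "{x \<in> part_pairs l n. \<forall>k. \<not> active k x}"
  have inactive_iff: "(\<forall>k. \<not> active k (E, P)) \<longleftrightarrow> distinct_parts P \<and> (\<forall>p\<in>#P. odd p)" for E P
  proof
    assume inactive: "\<forall>k. \<not> active k (E, P)"
    then have one: "count P p = 1" if "p \<in># P" for p
    proof -
      have "\<not> 2 \<le> count P p"
        using inactive by (simp add: active_def)
      moreover have "0 < count P p"
        using that by simp
      ultimately show ?thesis
        by linarith
    qed
    \<comment> \<open>An even part \<open>2 * j\<close> would have multiplicity 1, which is odd,
      making \<open>j\<close> active.\<close>
    moreover have "odd p" if "p \<in># P" for p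
      using inactive one[OF that] unfolding active_def by (metis evenE odd_one snd_conv)
    ultimately show "distinct_parts P \<and> (\<forall>p\<in>#P. odd p)"
      by (auto simp: distinct_parts_def)
  next
    assume P: "distinct_parts P \<and> (\<forall>p\<in>#P. odd p)"
    have "count P k < 2" for k
      using P by (cases "k \<in># P") (auto simp: distinct_parts_def not_in_iff)
    moreover have "count P (2 * k) = 0" for k
      using P by (auto simp: count_eq_zero_iff)
    ultimately show "\<forall>k. \<not> active k (E, P)"
      by (simp add: active_def not_le)
  qed
  have "even (card (part_pairs l n)) \<longleftrightarrow> even (card ?B)"
  proof (rule even_card_least_toggle[where t = split_part, OF finite_part_pairs])
    fix k x assume "x \<in> part_pairs l n" and "active k x"
    moreover obtain E P where x: "x = (E, P)"
      by (cases x)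
    ultimately have EP: "(E, P) \<in> part_pairs l n"
      and k: "2 \<le> count P k \<or> odd (count P (2 * k))"
      by (auto simp: active_def)
    \<comment> \<open>This excludes \<open>k = 0\<close>, so \<open>2 * k\<close> and
      \<open>k\<close> are different parts.\<close>
    have "count P 0 = 0"
      using EP by (auto simp: part_pairs_def count_eq_zero_iff)
    with k have "k > 0"
      by (cases "k = 0") auto
    consider (split) Q where "odd (count P (2 * k))" "P = add_mset (2 * k) Q"
      | (merge) Q where "even (count P (2 * k))" "P = add_mset k (add_mset k Q)"
    proof (cases "odd (count P (2 * k))")
      case True
      then have "2 * k \<in># P"
        by (metis count_eq_zero_iff even_zero)
      with True split show ?thesis
        by (metis multi_member_split)
    next
      case False
      with k have "{#k, k#} \<subseteq># P"
        by (auto simp: subseteq_mset_def)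
      with False merge show ?thesis
        by (metis mset_subset_eq_exists_conv union_mset_add_mset_left add_0)
    qed
    note cases = this
    \<comment> \<open>For the activity of the index \<open>2 * k\<close>: its multiplicity changes
      between some 2m and 2m + 1, and each of these is at least 2 exactly when m > 0. For an index
      \<open>i\<close> with \<open>2 * i = k\<close>, the multiplicity of \<open>k\<close> changes
      by 2 and keeps its parity.\<close>
    have two_le: "2 \<le> count M j \<longleftrightarrow> j \<in># M" if "even (count M j)" for M and j :: nat
      using that by (cases "count M j") (auto simp: Suc_le_eq odd_pos simp flip: count_greater_zero_iff)
    show "split_part k x \<in> part_pairs l n"
      using cases by cases (use EP \<open>k > 0\<close> in \<open>auto simp: x part_pairs_def\<close>)
    show "split_part k (split_part k x) = x"
      using cases by cases (use \<open>k > 0\<close> in \<open>auto simp: x\<close>)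
    show "split_part k x \<noteq> x"
    proof
      \<comment> \<open>Splitting adds one part in total and merging removes one.\<close>
      assume "split_part k x = x"
      then have "size (snd (split_part k x)) = size P"
        by (simp add: x)
      with cases show False
        by cases (auto simp: x)
    qed
    show "active i (split_part k x) \<longleftrightarrow> active i x" for i
      using cases by cases (use \<open>k > 0\<close> in \<open>auto simp: x active_def two_le\<close>)
  qed
  also have "?B = {(E, P) \<in> part_pairs l n. distinct_parts P \<and> (\<forall>p\<in>#P. odd p)}"
    using inactive_iff by auto
  finally show ?thesis .
qed

text \<open>Since \<open>l\<close> is even, \<open>E\<close> has only even elements while
  \<open>P\<close> has only odd parts. Their union therefore has distinct parts, and sorting its
  parts by parity recovers the pair.\<close>

lemma card_distinct_odd_pairs:
  assumes "even l"
  shows "card {(E, P) \<in> part_pairs l n. distinct_parts P \<and> (\<forall>p\<in>#P. odd p)} =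
    card {P \<in> partitions_of n. distinct_parts P \<and> (\<forall>p\<in>#P. odd p \<or> l dvd p)}"
    (is "card ?A = card ?B")
proof (rule bij_betw_same_card[OF bij_betw_byWitness])
  let ?f = "\<lambda>(E, P). mset_set E + P"
  let ?g = "\<lambda>P. ({p \<in> set_mset P. even p}, filter_mset odd P)"
  have E_even: "even k" if "(E, P) \<in> part_pairs l n" "k \<in> E" for E P k
    using that assms by (auto simp: part_pairs_def intro: dvd_trans)
  show "\<forall>x\<in>?A. ?g (?f x) = x"
  proof
    fix x assume "x \<in> ?A"
    then obtain E P where x: "x = (E, P)" and EP: "(E, P) \<in> part_pairs l n" "\<forall>p\<in>#P. odd p"
      by blast
    from EP have "finite E"
      by (simp add: part_pairs_def)
    moreover have "filter_mset odd (mset_set E) = {#}"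
      using EP E_even \<open>finite E\<close> by (auto simp: mset_set_empty_iff)
    moreover have "filter_mset odd P = P"
      using EP by (auto simp: filter_mset_eq_conv)
    ultimately show "?g (?f x) = x"
      using EP E_even by (auto simp: x)
  qed
  \<comment> \<open>Distinctness ensures that passing to the set of even parts loses no
    multiplicity.\<close>
  have split: "mset_set {p \<in> set_mset P. even p} + filter_mset odd P = P" if "distinct_parts P" for P
    using that by (auto simp: distinct_parts_def multiset_eq_iff count_mset_set' not_in_iff)
  then show "\<forall>P\<in>?B. ?f (?g P) = P"
    by auto
  show "?f ` ?A \<subseteq> ?B"
  proof
    fix R assume "R \<in> ?f ` ?A"
    then obtain E P where R: "R = mset_set E + P"
      and EP: "(E, P) \<in> part_pairs l n" "distinct_parts P" "\<forall>p\<in>#P. odd p"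
      by auto
    from EP have E: "finite E"
      by (simp add: part_pairs_def)
    have disjoint: "k \<notin># P" if "k \<in> E" for k
      using E_even[OF EP(1) that] EP(3) by blast
    have "distinct_parts (mset_set E + P)"
      using EP(2) E disjoint by (auto simp: distinct_parts_def count_mset_set' not_in_iff)
    moreover have "mset_set E + P \<in> partitions_of n"
      using EP E by (auto simp: part_pairs_def partitions_of_def sum_unfold_sum_mset)
    moreover have "odd p \<or> l dvd p" if "p \<in># mset_set E + P" for p
      using that EP E by (auto simp: part_pairs_def)
    ultimately show "R \<in> ?B"
      by (simp add: R)
  qed
  show "?g ` ?B \<subseteq> ?A"
  proof
    fix x assume "x \<in> ?g ` ?B"
    then obtain P where x: "x = ?g P"
      and P: "P \<in> partitions_of n" "distinct_parts P" "\<forall>p\<in>#P. odd p \<or> l dvd p"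
      by (elim imageE) simp
    have "\<Sum>{p \<in> set_mset P. even p} + sum_mset (filter_mset odd P) = n"
      using arg_cong[OF split[OF P(2)], of sum_mset] P(1)
      by (simp add: partitions_of_def sum_unfold_sum_mset)
    then show "x \<in> ?A"
      using P by (auto simp: x part_pairs_def partitions_of_def distinct_parts_def)
  qed
qed

text \<open>The residues allowed modulo 6 are 0, 1, 3 and 5.\<close>

lemma not_cong_pm2_mod_6_iff:
  "\<not> [int p = 2] (mod 6) \<and> \<not> [int p = - 2] (mod 6) \<longleftrightarrow> odd p \<or> 6 dvd p"
  unfolding cong_def by simp presburger

theorem corollary1p4:
  fixes n :: nat
  shows "even (Q2 n) \<longleftrightarrow> even (b6 n)"
  unfolding Q2_def b6_def not_cong_pm2_mod_6_iff
  using even_card_part_pairs_regular[of 6 n] even_card_part_pairs_distinct_odd[of 6 n]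
    card_distinct_odd_pairs[of 6 n]
  by simp

end
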